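(* Let $(G,\textsc{mw}_{w,F},\lambda,\gamma)$ be a stochastic matching model with reneging, with generator $\mathcal L$ on $\mathcal X$, and assume $\lambda\in\textsc{Ncond}(G,\gamma)$. Then for every sufficiently small $\alpha>0$ there exist $C,K>0$ such that $$\mathcal L e^{\alpha\|x\|}\le -C e^{\alpha\|x\|}$$ for every $x\in\mathcal X$ with $\|x\|\ge K$, where $\mathcal L e^{\alpha\|x\|}$ denotes $\mathcal L$ applied to the function $y\mapsto e^{\alpha\|y\|}$, evaluated at $x$.
   Context: Setting. $G=(V,E)$ is a finite, simple, undirected, connected graph; edges are written $\langle i,j\rangle$. For $A\subset V$, $E(A)=\{i\in V:\langle i,j\rangle\in E\text{ for some }j\in A\}$ and $E(i)=E(\{i\})$. An independent set is a nonempty $I\subset V$ such that $i,j\in I$ implies $\langle i,j\rangle\notin E$; $\mathbb I(A)$ is the set of independent sets contained in $A$. Arrival rates: $\lambda=(\lambda(i))_{i\in V}$ with $\lambda(i)>0$; $\lambda(A)=\sum_{i\in A}\lambda(i)$. Reneging rates: $\gamma=(\gamma(i))_{i\in V}$ with $\gamma(i)\ge0$; $R=\{i\in V:\gamma(i)>0\}$, $R^c=\{i\in V:\gamma(i)=0\}$. Rewards: $w=(w_{(j,i)})$, nonnegative numbers indexed by ordered pairs $(j,i)$ with $\langle i,j\rangle\in E$ (not assumed symmetric). Errors: $F=(F_{(j,i)})$ is a family of cumulative distribution functions, and $U_{(j,i)}$ ($\langle i,j\rangle\in E$) are mutually independent real random variables, $U_{(j,i)}$ having cdf $F_{(j,i)}$.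 State space: $\mathcal X=\{x\in\mathbb N_0^{V}:x(i)x(j)=0\text{ whenever }\langle i,j\rangle\in E\}$; $\mathrm{supp}(x)=\{i:x(i)>0\}$; $\delta_i$ is the $i$-th canonical vector; $\|x\|=(\sum_{i\in V}x(i)^2)^{1/2}$. Model $(G,\textsc{mw}_{w,F},\lambda,\gamma)$ (generalized Max-Weight policy): class-$i$ items arrive according to independent Poisson processes of rate $\lambda(i)$; each stored $i$-item independently reneges at rate $\gamma(i)$; an arriving $j$-item that finds no stored item with class in $E(j)$ is stored; otherwise it is immediately matched (both items leave) with a stored item whose class is chosen uniformly at random in $\arg\max_{i\in E(j):x(i)>0}\big([x(i)+U_{(j,i)}]^++w_{(j,i)}\big)$, where $x$ is the current queue-length vector and the errors $U_{(j,i)}$ are drawn afresh at each arrival, independently of everything else. For $j\in V$ and $i\in E(j)$, $\nu_{x,j}(i)$ denotes the probability that an arriving $j$-item in state $x$ is matched with an $i$-item. The queue-length process $X=(X_t)_{t\ge0}$ is the continuous-time Markov chain on $\mathcal X$ with generator $$\mathcal Lf(x)=\sum_{i\notin E(\mathrm{supp}(x))}\lambda(i)[f(x+\delta_i)-f(x)]+\sum_{i\in\mathrm{supp}(x)}\Big[\gamma(i)x(i)+\sum_{j\in E(i)}\lambda(j)\nu_{x,j}(i)\Big][f(x-\delta_i)-f(x)].$$ $\textsc{Ncond}(G,\gamma)=\{\lambda\in(0,\infty)^{|V|}:\lambda(I)<\lambda(E(I))\text{ for any }I\in\mathbb I(R^c)\}$. *)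

theory Defs
  imports "HOL-Probability.Probability" "Graph_Theory.Graph_Theory"
begin

text \<open>
  A finite simple undirected graph is a \<^locale>\<open>pair_graph\<close>: a finite loop-free digraph whose arc
  relation is symmetric, so that an undirected edge between \<open>i\<close> and \<open>j\<close> is the pair of arcs
  \<open>(i, j)\<close> and \<open>(j, i)\<close>. A family indexed by the ordered pairs \<open>(j, i)\<close> of adjacent classes
  (\<open>j\<close> the class of the arriving item, \<open>i\<close> that of the stored one) is a function on pairs, of
  which only the values on \<open>parcs G\<close> matter.
\<close>

definition nbrs :: "'v pair_pre_digraph \<Rightarrow> 'v set \<Rightarrow> 'v set" where
  "nbrs G A = {i \<in> pverts G. \<exists>j\<in>A. (i, j) \<in> parcs G}"

definition indep_sets_in :: "'v pair_pre_digraph \<Rightarrow> 'v set \<Rightarrow> 'v set set" where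
  "indep_sets_in G A =
     {I. I \<noteq> {} \<and> I \<subseteq> pverts G \<and> (\<forall>i\<in>I. \<forall>j\<in>I. (i, j) \<notin> parcs G) \<and> I \<subseteq> A}"

definition Ncond :: "'v pair_pre_digraph \<Rightarrow> ('v \<Rightarrow> real) \<Rightarrow> ('v \<Rightarrow> real) set" where
  "Ncond G \<gamma> = {lam. (\<forall>i\<in>pverts G. 0 < lam i) \<and>
     (\<forall>I\<in>indep_sets_in G {i \<in> pverts G. \<gamma> i = 0}. sum lam I < sum lam (nbrs G I))}"

text \<open>
  A vector indexed by the vertices is a function on the whole vertex type; states vanish outside
  \<open>pverts G\<close>, so that each state is represented exactly once.
\<close>

definition state_space :: "'v pair_pre_digraph \<Rightarrow> ('v \<Rightarrow> nat) set" where
  "state_space G =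
     {x. (\<forall>i. i \<notin> pverts G \<longrightarrow> x i = 0) \<and> (\<forall>(i, j)\<in>parcs G. x i * x j = 0)}"

definition supp :: "'v pair_pre_digraph \<Rightarrow> ('v \<Rightarrow> nat) \<Rightarrow> 'v set" where
  "supp G x = {i \<in> pverts G. 0 < x i}"

definition state_norm :: "'v pair_pre_digraph \<Rightarrow> ('v \<Rightarrow> nat) \<Rightarrow> real" where
  "state_norm G x = L2_set (\<lambda>i. real (x i)) (pverts G)"

text \<open>The data of the model; the errors \<open>U\<close> are realised on a probability space \<open>M\<close>.\<close>

locale stochastic_matching_model = pair_graph G + prob_space M
  for G :: "'v pair_pre_digraph"
    and w :: "'v \<times> 'v \<Rightarrow> real"
    and F :: "'v \<times> 'v \<Rightarrow> real \<Rightarrow> real"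
    and lam :: "'v \<Rightarrow> real"
    and \<gamma> :: "'v \<Rightarrow> real"
    and M :: "'m measure"
    and U :: "'v \<times> 'v \<Rightarrow> 'm \<Rightarrow> real" +
  assumes graph_connected: "Digraph_Component.connected (with_proj G)"
    and arrival_pos: "i \<in> pverts G \<Longrightarrow> 0 < lam i"
    and reneging_nonneg: "i \<in> pverts G \<Longrightarrow> 0 \<le> \<gamma> i"
    and reward_nonneg: "e \<in> parcs G \<Longrightarrow> 0 \<le> w e"
    and errors_indep: "indep_vars (\<lambda>_. borel) U (parcs G)"
    and errors_cdf: "e \<in> parcs G \<Longrightarrow> cdf (distr M borel (U e)) = F e"

text \<open>
  The stored classes maximising the perturbed score seen by an arriving \<open>j\<close>-item in state \<open>x\<close>,
  for the realisation \<open>\<omega>\<close> of the errors.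
\<close>

definition mw_argmax ::
  "'v pair_pre_digraph \<Rightarrow> ('v \<times> 'v \<Rightarrow> real) \<Rightarrow> ('v \<times> 'v \<Rightarrow> 'm \<Rightarrow> real) \<Rightarrow>
   ('v \<Rightarrow> nat) \<Rightarrow> 'v \<Rightarrow> 'm \<Rightarrow> 'v set" where
  "mw_argmax G w U x j \<omega> =
     {i. is_arg_max (\<lambda>i. max 0 (real (x i) + U (j, i) \<omega>) + w (j, i))
           (\<lambda>i. i \<in> nbrs G {j} \<and> 0 < x i) i}"

text \<open>
  The probability that an arriving \<open>j\<close>-item is matched with an \<open>i\<close>-item: the law of a uniform
  choice in the (random) set of maximisers, averaged over the errors. The guard excludes the
  classes that cannot be matched; when it holds, the set of maximisers is finite and nonempty,
  as \<^const>\<open>pmf_of_set\<close> requires.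
\<close>

definition match_prob ::
  "'v pair_pre_digraph \<Rightarrow> ('v \<times> 'v \<Rightarrow> real) \<Rightarrow> 'm measure \<Rightarrow> ('v \<times> 'v \<Rightarrow> 'm \<Rightarrow> real) \<Rightarrow>
   ('v \<Rightarrow> nat) \<Rightarrow> 'v \<Rightarrow> 'v \<Rightarrow> real" where
  "match_prob G w M U x j i =
     (if i \<in> nbrs G {j} \<and> 0 < x i
      then (\<integral>\<omega>. pmf (pmf_of_set (mw_argmax G w U x j \<omega>)) i \<partial>M) else 0)"

definition generator ::
  "'v pair_pre_digraph \<Rightarrow> ('v \<times> 'v \<Rightarrow> real) \<Rightarrow> ('v \<Rightarrow> real) \<Rightarrow> ('v \<Rightarrow> real) \<Rightarrow>
   'm measure \<Rightarrow> ('v \<times> 'v \<Rightarrow> 'm \<Rightarrow> real) \<Rightarrow> (('v \<Rightarrow> nat) \<Rightarrow> real) \<Rightarrow> ('v \<Rightarrow> nat) \<Rightarrow> real" where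
  "generator G w lam \<gamma> M U f x =
     (\<Sum>i\<in>pverts G - nbrs G (supp G x). lam i * (f (x(i := x i + 1)) - f x)) +
     (\<Sum>i\<in>supp G x.
        (\<gamma> i * real (x i) + (\<Sum>j\<in>nbrs G {i}. lam j * match_prob G w M U x j i)) *
        (f (x(i := x i - 1)) - f x))"

end

theory Submission
  imports Defs
begin

text \<open>
  Write \<open>N = \<parallel>x\<parallel>\<close> and let \<open>m j\<close> be the longest queue among the neighbours of \<open>j\<close>. An arrival or a
  match at \<open>i\<close> changes \<open>N\<close> by about \<open>\<plusminus> x i / N\<close>, so to first order in \<open>\<alpha>\<close> the drift of
  \<open>exp (\<alpha> N)\<close>, relative to its value, is at most \<open>\<alpha> / N\<close> times
  \<open>(\<Sum>i. lam i * x i) - (\<Sum>j. lam j * m j) - (\<Sum>i. \<gamma> i * (x i)\<^sup>2 / 4)\<close>.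
  Slicing the queues of the classes that do not renege into superlevel sets, which are
  independent, \<open>Ncond\<close> gives \<open>(\<Sum>i. (lam i + \<delta>) * x i) \<le> (\<Sum>j. lam j * m j)\<close> over these classes for
  some \<open>\<delta> > 0\<close>; for the other classes the quadratic term absorbs the linear one. So the
  first-order drift is at most \<open>(\<alpha> / N) * (B - \<delta> N)\<close>, and the remaining errors are
  at most \<open>\<alpha> \<delta> / 2\<close> up to \<open>O(\<alpha> / N)\<close>.
\<close>

section \<open>Elementary inequalities and summation over levels\<close>

lemma exp_le_one_plus_quadratic:
  fixes u :: real
  assumes "\<bar>u\<bar> \<le> 1"
  shows "exp u \<le> 1 + u + u\<^sup>2"
proof (cases "0 \<le> u")
  case True
  then show ?thesis
    using assms exp_bound[of u] by simp
next
  case False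
  \<comment> \<open>With \<open>u = - v\<close>, the claim amounts to
    \<open>1 \<le> (1 - v + v\<^sup>2) * exp v\<close>. The quadratic Taylor lower bound for
    \<open>exp v\<close> suffices, because in the product the terms in \<open>v\<close> cancel and
    only nonnegative ones remain besides 1.\<close>
  define v where "v = - u"
  have v: "0 \<le> v" using False by (simp add: v_def)
  have "1 \<le> 1 + v^2 / 2 + v^3 / 2 + v^4 / 2"
    using v by simp
  also have "\<dots> = (1 - v + v\<^sup>2) * (1 + v + v\<^sup>2 / 2)"
    by (simp add: field_simps power2_eq_square power3_eq_cube power4_eq_xxxx)
  also have "\<dots> \<le> (1 - v + v\<^sup>2) * exp v"
  proof (rule mult_left_mono)
    show "1 + v + v\<^sup>2 / 2 \<le> exp v" using exp_lower_Taylor_quadratic[OF v] .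
    show "0 \<le> 1 - v + v\<^sup>2"
      using v assms unfolding v_def by simp
  qed
  finally have "exp (- v) \<le> 1 - v + v\<^sup>2"
    by (simp add: exp_minus field_simps)
  then show ?thesis by (simp add: v_def)
qed

text \<open>Layer-cake summation: \<open>f i\<close> counts the levels \<open>t < T\<close> lying
  strictly below it, and the two sums are exchanged.\<close>

lemma sum_mult_nat_eq_sum_superlevel:
  fixes a :: "'a \<Rightarrow> real" and f :: "'a \<Rightarrow> nat"
  assumes "finite A" and "\<And>i. i \<in> A \<Longrightarrow> f i \<le> T"
  shows "(\<Sum>i\<in>A. a i * real (f i)) = (\<Sum>t<T. sum a {i \<in> A. t < f i})"
proof -
  have "a i * real (f i) = (\<Sum>t<T. if t < f i then a i else 0)" if "i \<in> A" for i
  proof -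
    have "(\<Sum>t<T. if t < f i then a i else 0) = sum (\<lambda>_. a i) {t \<in> {..<T}. t < f i}"
      by (rule sum.inter_filter[symmetric]) simp
    also have "{t \<in> {..<T}. t < f i} = {..<f i}"
      using assms(2)[OF that] by auto
    finally show ?thesis by simp
  qed
  then have "(\<Sum>i\<in>A. a i * real (f i)) = (\<Sum>i\<in>A. \<Sum>t<T. if t < f i then a i else 0)"
    by simp
  also have "\<dots> = (\<Sum>t<T. \<Sum>i\<in>A. if t < f i then a i else 0)"
    by (rule sum.swap)
  also have "\<dots> = (\<Sum>t<T. sum a {i \<in> A. t < f i})"
    by (simp add: sum.inter_filter[OF assms(1)])
  finally show ?thesis .
qed

text \<open>Completing the square: the left side is maximal at \<open>t = 2 * a / g\<close>.\<close>

lemma linear_minus_quadratic_le: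
  fixes a g t :: real
  assumes "0 < g"
  shows "a * t - g * t\<^sup>2 / 4 \<le> a\<^sup>2 / g"
proof -
  have "0 \<le> (g * t / 2 - a)\<^sup>2 / g"
    using assms by simp
  also have "\<dots> = g * t\<^sup>2 / 4 - a * t + a\<^sup>2 / g"
    using assms by (simp add: field_simps power2_eq_square)
  finally show ?thesis by simp
qed

section \<open>Euclidean norm of a state and its one-step changes\<close>

context pair_graph
begin

lemma state_norm_nonneg: "0 \<le> state_norm G x"
  by (simp add: state_norm_def)

lemma state_norm_power2: "(state_norm G x)\<^sup>2 = (\<Sum>i\<in>pverts G. (real (x i))\<^sup>2)"
  by (simp add: state_norm_def L2_set_def sum_nonneg)

lemma state_norm_upd_power2:
  assumes "i \<in> pverts G"
  shows "(state_norm G (x(i := n)))\<^sup>2 = (state_norm G x)\<^sup>2 - (real (x i))\<^sup>2 + (real n)\<^sup>2"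
proof -
  have "(\<Sum>k\<in>pverts G. (real ((x(i := n)) k))\<^sup>2) = (real n)\<^sup>2 + (\<Sum>k\<in>pverts G - {i}. (real (x k))\<^sup>2)"
    using assms by (simp add: sum.remove)
  moreover have "(\<Sum>k\<in>pverts G. (real (x k))\<^sup>2) = (real (x i))\<^sup>2 + (\<Sum>k\<in>pverts G - {i}. (real (x k))\<^sup>2)"
    using assms by (simp add: sum.remove)
  ultimately show ?thesis
    unfolding state_norm_power2 by simp
qed

lemma le_state_norm: "i \<in> pverts G \<Longrightarrow> real (x i) \<le> state_norm G x"
  unfolding state_norm_def by (rule member_le_L2_set) auto

lemma state_norm_le_sum: "state_norm G x \<le> (\<Sum>i\<in>pverts G. real (x i))"
  unfolding state_norm_def by (rule L2_set_le_sum) auto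

text \<open>Factor the difference of squares, \<open>(N' - N) * (N' + N) = 2 * x i + 1\<close>, and
  use \<open>N' + N \<ge> 2 * N\<close>. The bound by 1 comes from \<open>x i \<le> N\<close>, which
  gives \<open>N'\<^sup>2 \<le> (N + 1)\<^sup>2\<close>.\<close>

lemma state_norm_incr:
  assumes "i \<in> pverts G" and "1 \<le> state_norm G x"
  defines "N \<equiv> state_norm G x" and "N' \<equiv> state_norm G (x(i := x i + 1))"
  shows "0 \<le> N' - N" "N' - N \<le> 1" "N' - N \<le> (2 * real (x i) + 1) / (2 * N)"
proof -
  have sq: "N'\<^sup>2 = N\<^sup>2 + (2 * real (x i) + 1)"
    unfolding N_def N'_def state_norm_upd_power2[OF assms(1)]
    by (simp add: power2_eq_square algebra_simps)
  have N: "1 \<le> N" using assms by simp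
  have N': "0 \<le> N'" unfolding N'_def by (rule state_norm_nonneg)
  show le: "0 \<le> N' - N"
    using power2_le_imp_le[of N N'] sq N' by simp
  have eq: "(N' - N) * (N' + N) = 2 * real (x i) + 1"
    using sq by (simp add: power2_eq_square algebra_simps)
  have "N'\<^sup>2 \<le> (N + 1)\<^sup>2"
    using le_state_norm[OF assms(1), of x] unfolding sq N_def[symmetric]
    by (simp add: power2_eq_square algebra_simps)
  then show "N' - N \<le> 1"
    using power2_le_imp_le[of N' "N + 1"] N by simp
  have "(N' - N) * (2 * N) \<le> (N' - N) * (N' + N)"
    using le by (intro mult_left_mono) auto
  then show "N' - N \<le> (2 * real (x i) + 1) / (2 * N)"
    using N eq by (simp add: field_simps)
qed

text \<open>Same factorisation as for an increase. Now \<open>N' + N \<le> 2 * N\<close>, but the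
  difference is negative, so replacing the sum by \<open>2 * N\<close> again gives an upper
  bound.\<close>

lemma state_norm_decr:
  assumes "i \<in> pverts G" and "0 < x i" and "1 \<le> state_norm G x"
  defines "N \<equiv> state_norm G x" and "N' \<equiv> state_norm G (x(i := x i - 1))"
  shows "N' - N \<le> 0" "-1 \<le> N' - N" "N' - N \<le> (1 - 2 * real (x i)) / (2 * N)"
proof -
  have r: "real (x i - 1) = real (x i) - 1" "1 \<le> real (x i)"
    using assms(2) by auto
  have sq: "N'\<^sup>2 = N\<^sup>2 + (1 - 2 * real (x i))"
    unfolding N_def N'_def state_norm_upd_power2[OF assms(1)] r
    by (simp add: power2_eq_square algebra_simps)
  have N: "1 \<le> N" using assms by simp
  have N': "0 \<le> N'" unfolding N'_def by (rule state_norm_nonneg)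
  show le: "N' - N \<le> 0"
    using power2_le_imp_le[of N' N] sq N r(2) by simp
  have eq: "(N - N') * (N' + N) = 2 * real (x i) - 1"
    using sq by (simp add: power2_eq_square algebra_simps)
  have "(N - 1)\<^sup>2 \<le> N'\<^sup>2"
    using le_state_norm[OF assms(1), of x] unfolding sq N_def[symmetric]
    by (simp add: power2_eq_square algebra_simps)
  then show "-1 \<le> N' - N"
    using power2_le_imp_le[of "N - 1" N'] N' by simp
  have "(N - N') * (N' + N) \<le> (N - N') * (2 * N)"
    using le by (intro mult_left_mono) auto
  then show "N' - N \<le> (1 - 2 * real (x i)) / (2 * N)"
    using N eq by (simp add: field_simps)
qed

section \<open>Longest neighbouring queues and the stability condition\<close>

text \<open>The inserted \<open>0\<close> fixes the value for a vertex without neighbours and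
  changes nothing otherwise.\<close>

definition max_nbr_queue :: "('a \<Rightarrow> nat) \<Rightarrow> 'a \<Rightarrow> nat" where
  "max_nbr_queue x j = Max (insert 0 (x ` nbrs G {j}))"

lemma finite_nbrs [simp]: "finite (nbrs G A)"
  by (simp add: nbrs_def)

lemma max_nbr_queue_greater_iff:
  "t < max_nbr_queue x j \<longleftrightarrow> (\<exists>i\<in>nbrs G {j}. t < x i)"
  unfolding max_nbr_queue_def by (subst Max_gr_iff) auto

lemma max_nbr_queue_attained:
  assumes "0 < max_nbr_queue x j"
  obtains i where "i \<in> nbrs G {j}" "x i = max_nbr_queue x j"
proof -
  have "Max (insert 0 (x ` nbrs G {j})) \<in> insert 0 (x ` nbrs G {j})"
    by (rule Max_in) auto
  then show thesis
    using assms that unfolding max_nbr_queue_def by auto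
qed

lemma mem_nbrs_single: "i \<in> nbrs G {j} \<longleftrightarrow> (j, i) \<in> parcs G"
  using wellformed[of "(i, j)"] graph_symmetric by (auto simp: nbrs_def dest: symD)

lemma max_nbr_queue_le_norm: "real (max_nbr_queue x j) \<le> state_norm G x"
proof (cases "0 < max_nbr_queue x j")
  case True
  then obtain i where "i \<in> nbrs G {j}" "x i = max_nbr_queue x j"
    by (rule max_nbr_queue_attained)
  then show ?thesis
    using le_state_norm[of i x] by (auto simp: nbrs_def)
qed (simp add: state_norm_nonneg)

text \<open>There are finitely many independent sets, so the strict inequalities have a common
  positive slack. Dividing by \<open>card I\<close> spreads it over the vertices, which is the form
  that slicing by levels requires.\<close>

lemma Ncond_uniform_gap:
  assumes "lam \<in> Ncond G \<gamma>"
  obtains \<delta> where "0 < \<delta>"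
    "\<And>I. I \<in> indep_sets_in G {i \<in> pverts G. \<gamma> i = 0} \<Longrightarrow>
       (\<Sum>i\<in>I. lam i + \<delta>) \<le> sum lam (nbrs G I)"
proof -
  let ?S = "indep_sets_in G {i \<in> pverts G. \<gamma> i = 0}"
  let ?gap = "\<lambda>I. (sum lam (nbrs G I) - sum lam I) / real (card I)"
  \<comment> \<open>The inserted \<open>1\<close> covers an empty family, for instance when every
    class reneges.\<close>
  define \<delta> where "\<delta> = Min (insert 1 (?gap ` ?S))"
  have "finite ?S"
    by (rule finite_subset[of _ "Pow (pverts G)"]) (auto simp: indep_sets_in_def)
  moreover have card: "0 < real (card I)" if "I \<in> ?S" for I
    using that finite_subset[OF _ finite_verts] by (auto simp: indep_sets_in_def card_gt_0_iff)
  moreover have "sum lam I < sum lam (nbrs G I)" if "I \<in> ?S" for I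
    using assms that by (auto simp: Ncond_def)
  ultimately have "0 < \<delta>"
    unfolding \<delta>_def by (subst Min_gr_iff) auto
  moreover have "(\<Sum>i\<in>I. lam i + \<delta>) \<le> sum lam (nbrs G I)" if "I \<in> ?S" for I
  proof -
    have "\<delta> \<le> ?gap I"
      unfolding \<delta>_def using \<open>finite ?S\<close> that by (intro Min_le) auto
    then show ?thesis
      using card[OF that] by (simp add: sum.distrib field_simps)
  qed
  ultimately show thesis by (rule that)
qed

text \<open>Both sides are sums over levels \<open>t\<close>, and \<open>gap\<close> compares them
  level by level: the neighbourhood of a superlevel set of \<open>x\<close> lies in the superlevel
  set of \<open>max_nbr_queue x\<close>.\<close>

lemma sum_queue_le_sum_max_nbr_queue:
  assumes lam: "\<And>i. i \<in> pverts G \<Longrightarrow> 0 \<le> lam i"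
    and gap: "\<And>I. I \<in> indep_sets_in G S \<Longrightarrow> (\<Sum>i\<in>I. lam i + \<delta>) \<le> sum lam (nbrs G I)"
    and S: "S \<subseteq> pverts G" and x: "x \<in> state_space G"
  shows "(\<Sum>i\<in>S. (lam i + \<delta>) * real (x i)) \<le> (\<Sum>j\<in>pverts G. lam j * real (max_nbr_queue x j))"
proof -
  \<comment> \<open>A common bound on all queues, so that both sides are sliced over the same range
    of levels.\<close>
  define T where "T = Max (insert 0 (x ` pverts G))"
  have T: "x i \<le> T" if "i \<in> pverts G" for i
    unfolding T_def using that by (intro Max_ge) auto
  have "max_nbr_queue x j \<le> T" for j
    unfolding max_nbr_queue_def T_def by (intro Max_mono) (auto simp: nbrs_def)
  then have "(\<Sum>j\<in>pverts G. lam j * real (max_nbr_queue x j)) =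
      (\<Sum>t<T. sum lam {j \<in> pverts G. t < max_nbr_queue x j})"
    by (intro sum_mult_nat_eq_sum_superlevel) auto
  moreover have "(\<Sum>i\<in>S. (lam i + \<delta>) * real (x i)) = (\<Sum>t<T. \<Sum>i\<in>{i \<in> S. t < x i}. lam i + \<delta>)"
    using S T finite_subset[OF S] by (intro sum_mult_nat_eq_sum_superlevel) auto
  moreover have "(\<Sum>i\<in>{i \<in> S. t < x i}. lam i + \<delta>) \<le> sum lam {j \<in> pverts G. t < max_nbr_queue x j}"
    for t
  \<comment> \<open>Independent sets are nonempty by definition, so \<open>gap\<close> says nothing
    about an empty level.\<close>
  proof (cases "{i \<in> S. t < x i} = {}")
    case True
    then show ?thesis unfolding True using lam by (auto intro: sum_nonneg)
  next
    case False
    \<comment> \<open>Adjacent queues of a state are never both positive, hence never both above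
      \<open>t\<close>.\<close>
    have "x i * x j = 0" if "(i, j) \<in> parcs G" for i j
      using x that by (auto simp: state_space_def)
    then have "{i \<in> S. t < x i} \<in> indep_sets_in G S"
      using False S unfolding indep_sets_in_def by fastforce
    then have "(\<Sum>i\<in>{i \<in> S. t < x i}. lam i + \<delta>) \<le> sum lam (nbrs G {i \<in> S. t < x i})"
      by (rule gap)
    also have "\<dots> \<le> sum lam {j \<in> pverts G. t < max_nbr_queue x j}"
    proof (rule sum_mono2)
      show "nbrs G {i \<in> S. t < x i} \<subseteq> {j \<in> pverts G. t < max_nbr_queue x j}"
        using mem_nbrs_single by (auto simp: max_nbr_queue_greater_iff nbrs_def)
    qed (use lam in auto)
    finally show ?thesis .
  qed
  ultimately show ?thesis by (simp add: sum_mono)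
qed

end

section \<open>Tightness of the errors and matching probabilities\<close>

context stochastic_matching_model
begin

lemma lam_nonneg: "i \<in> pverts G \<Longrightarrow> 0 \<le> lam i"
  using arrival_pos[of i] by simp

lemma errors_measurable [measurable]: "e \<in> parcs G \<Longrightarrow> U e \<in> borel_measurable M"
  using errors_indep unfolding indep_vars_def2 by auto

text \<open>For each outcome the finitely many real errors have a common bound, so the events with
  bound \<open>n\<close> increase to the whole space, and continuity from below applies.\<close>

lemma errors_tight:
  assumes "0 < \<epsilon>"
  obtains B where "0 \<le> B" "{\<omega> \<in> space M. \<forall>e\<in>parcs G. \<bar>U e \<omega>\<bar> \<le> B} \<in> events"
    "1 - \<epsilon> \<le> prob {\<omega> \<in> space M. \<forall>e\<in>parcs G. \<bar>U e \<omega>\<bar> \<le> B}"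
proof -
  define A where "A n = {\<omega> \<in> space M. \<forall>e\<in>parcs G. \<bar>U e \<omega>\<bar> \<le> real n}" for n
  have ev: "A n \<in> events" for n
    unfolding A_def using pair_finite_arcs by measurable
  have "incseq A"
    unfolding A_def incseq_def by (force intro: order_trans)
  moreover have "(\<Union>n. A n) = space M"
  proof (intro equalityI subsetI)
    fix \<omega> assume \<omega>: "\<omega> \<in> space M"
    obtain n where "Max (insert 0 ((\<lambda>e. \<bar>U e \<omega>\<bar>) ` parcs G)) \<le> real n"
      using real_arch_simple by blast
    then have "\<omega> \<in> A n"
      using \<omega> pair_finite_arcs unfolding A_def by (subst (asm) Max_le_iff) auto
    then show "\<omega> \<in> (\<Union>n. A n)" by blast
  qed (auto simp: A_def)
  ultimately have "(\<lambda>n. prob (A n)) \<longlonglongrightarrow> 1"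
    using finite_Lim_measure_incseq[of A] ev prob_space by auto
  then have "eventually (\<lambda>n. 1 - \<epsilon> < prob (A n)) sequentially"
    by (rule order_tendstoD) (use assms in simp)
  then obtain n where "1 - \<epsilon> < prob (A n)"
    by (auto simp: eventually_sequentially)
  then show thesis
    using that[of "real n"] ev[of n] by (simp add: A_def)
qed

definition score :: "('v \<Rightarrow> nat) \<Rightarrow> 'v \<Rightarrow> 'm \<Rightarrow> 'v \<Rightarrow> real" where
  "score x j \<omega> i = max 0 (real (x i) + U (j, i) \<omega>) + w (j, i)"

lemma mem_mw_argmax_iff:
  "i \<in> mw_argmax G w U x j \<omega> \<longleftrightarrow>
     i \<in> nbrs G {j} \<inter> supp G x \<and> (\<forall>k\<in>nbrs G {j} \<inter> supp G x. score x j \<omega> k \<le> score x j \<omega> i)"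
  by (auto simp: mw_argmax_def is_arg_max_def supp_def nbrs_def score_def not_less)

lemma mw_argmax_subset: "mw_argmax G w U x j \<omega> \<subseteq> nbrs G {j} \<inter> supp G x"
  using mem_mw_argmax_iff by blast

lemma finite_mw_argmax [simp]: "finite (mw_argmax G w U x j \<omega>)"
  by (rule finite_subset[OF mw_argmax_subset]) simp

lemma mw_argmax_nonempty:
  assumes "nbrs G {j} \<inter> supp G x \<noteq> {}"
  shows "mw_argmax G w U x j \<omega> \<noteq> {}"
proof -
  let ?S = "nbrs G {j} \<inter> supp G x"
  have "Max (score x j \<omega> ` ?S) \<in> score x j \<omega> ` ?S"
    using assms by (intro Max_in) auto
  then obtain i where "i \<in> ?S" "score x j \<omega> i = Max (score x j \<omega> ` ?S)" by auto
  then have "i \<in> mw_argmax G w U x j \<omega>"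
    unfolding mem_mw_argmax_iff by auto
  then show ?thesis by blast
qed

text \<open>The matching probability conditional on the errors; its expectation is
  \<open>match_prob\<close> for the classes that can be matched.\<close>

definition choice_weight :: "('v \<Rightarrow> nat) \<Rightarrow> 'v \<Rightarrow> 'v \<Rightarrow> 'm \<Rightarrow> real" where
  "choice_weight x j i \<omega> = pmf (pmf_of_set (mw_argmax G w U x j \<omega>)) i"

text \<open>A quotient of finite sums of indicators: measurability of the uniform choice in a random
  set reduces to that of comparisons between scores.\<close>

lemma choice_weight_eq:
  assumes "nbrs G {j} \<inter> supp G x \<noteq> {}"
  shows "choice_weight x j i \<omega> = of_bool (i \<in> mw_argmax G w U x j \<omega>) /
    (\<Sum>k\<in>nbrs G {j} \<inter> supp G x. of_bool (k \<in> mw_argmax G w U x j \<omega>))"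
proof -
  have "(\<Sum>k\<in>nbrs G {j} \<inter> supp G x. of_bool (k \<in> mw_argmax G w U x j \<omega>) :: real) =
      real (card (mw_argmax G w U x j \<omega>))"
    using mw_argmax_subset[of x j \<omega>] by (simp add: Int_absorb1 inf.absorb_iff2)
  then show ?thesis
    unfolding choice_weight_def using mw_argmax_nonempty[OF assms]
    by (simp add: indicator_def of_bool_def)
qed

lemma choice_weight_measurable:
  assumes "nbrs G {j} \<inter> supp G x \<noteq> {}"
  shows "choice_weight x j i \<in> borel_measurable M"
proof -
  have U: "U (j, k) \<in> borel_measurable M" if "k \<in> nbrs G {j} \<inter> supp G x" for k
    using that by (intro errors_measurable) (simp add: mem_nbrs_single)
  have *: "(\<lambda>\<omega>. of_bool (k \<in> mw_argmax G w U x j \<omega>) :: real) \<in> borel_measurable M" for k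
  proof (cases "k \<in> nbrs G {j} \<inter> supp G x")
    case True
    have "Measurable.pred M (\<lambda>\<omega>. \<forall>l\<in>nbrs G {j} \<inter> supp G x. score x j \<omega> l \<le> score x j \<omega> k)"
      unfolding score_def using U U[OF True] by measurable
    then show ?thesis
      unfolding mem_mw_argmax_iff using True by simp
  next
    case False
    then have "k \<notin> mw_argmax G w U x j \<omega>" for \<omega>
      unfolding mem_mw_argmax_iff by blast
    then show ?thesis by simp
  qed
  show ?thesis
    unfolding choice_weight_eq[OF assms] using * by measurable
qed

lemma choice_weight_integrable:
  assumes "nbrs G {j} \<inter> supp G x \<noteq> {}"
  shows "integrable M (choice_weight x j i)"
  by (rule integrable_const_bound[of _ 1])
    (use choice_weight_measurable[OF assms] in \<open>auto simp: choice_weight_def pmf_le_1\<close>)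

lemma match_prob_eq:
  "i \<in> nbrs G {j} \<inter> supp G x \<Longrightarrow> match_prob G w M U x j i = expectation (choice_weight x j i)"
  by (auto simp: match_prob_def choice_weight_def[abs_def] supp_def)

lemma match_prob_nonneg: "0 \<le> match_prob G w M U x j i"
  by (simp add: match_prob_def)

lemma sum_choice_weight:
  assumes "nbrs G {j} \<inter> supp G x \<noteq> {}"
  shows "(\<Sum>i\<in>nbrs G {j} \<inter> supp G x. choice_weight x j i \<omega>) = 1"
  unfolding choice_weight_def
  using mw_argmax_nonempty[OF assms] mw_argmax_subset[of x j \<omega>]
  by (intro sum_pmf_eq_1) auto

text \<open>The sum is 1 if some neighbouring class is stored and 0 if none is.\<close>

lemma sum_match_prob_le_1: "(\<Sum>i\<in>nbrs G {j} \<inter> supp G x. match_prob G w M U x j i) \<le> 1"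
proof (cases "nbrs G {j} \<inter> supp G x = {}")
  case False
  have "(\<Sum>i\<in>nbrs G {j} \<inter> supp G x. match_prob G w M U x j i) =
      expectation (\<lambda>\<omega>. \<Sum>i\<in>nbrs G {j} \<inter> supp G x. choice_weight x j i \<omega>)"
    using choice_weight_integrable[OF False]
    by (simp add: match_prob_eq Bochner_Integration.integral_sum del: Int_iff)
  also have "\<dots> = 1"
    unfolding sum_choice_weight[OF False] using prob_space by simp
  finally show ?thesis by simp
qed simp

text \<open>
  Since the errors are tight, up to probability \<open>\<epsilon>\<close> the matched queue is the longest one
  available, up to a constant. No moment of the errors is needed.
\<close>

lemma expected_matched_queue_ge:
  assumes "0 < \<epsilon>"
  obtains C where "0 \<le> C"
    "\<And>x j. (1 - \<epsilon>) * real (max_nbr_queue x j) - C \<le>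
       (\<Sum>i\<in>nbrs G {j} \<inter> supp G x. match_prob G w M U x j i * real (x i))"
proof -
  obtain B where B: "0 \<le> B" "{\<omega> \<in> space M. \<forall>e\<in>parcs G. \<bar>U e \<omega>\<bar> \<le> B} \<in> events"
    "1 - \<epsilon> \<le> prob {\<omega> \<in> space M. \<forall>e\<in>parcs G. \<bar>U e \<omega>\<bar> \<le> B}"
    using errors_tight[OF assms] .
  define A where "A = {\<omega> \<in> space M. \<forall>e\<in>parcs G. \<bar>U e \<omega>\<bar> \<le> B}"
  define W where "W = sum w (parcs G)"
  \<comment> \<open>Passing from the longest queue to a maximiser of the score costs at most
    \<open>B\<close> for each of the two errors and \<open>W\<close> for the rewards.\<close>
  define C where "C = 2 * B + W"
  have wW: "w e \<le> W" if "e \<in> parcs G" for e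
    unfolding W_def using that reward_nonneg pair_finite_arcs by (intro member_le_sum) auto
  have W: "0 \<le> W" unfolding W_def by (intro sum_nonneg reward_nonneg)
  have C: "0 \<le> C" using W B(1) by (simp add: C_def)
  have "(1 - \<epsilon>) * real (max_nbr_queue x j) - C \<le>
       (\<Sum>i\<in>nbrs G {j} \<inter> supp G x. match_prob G w M U x j i * real (x i))" for x j
  proof (cases "max_nbr_queue x j = 0")
    case True
    then show ?thesis
      using C match_prob_nonneg
      by (simp add: add_increasing2 sum_nonneg order_trans[of "- C" 0])
  next
    case False
    then obtain k where k: "k \<in> nbrs G {j}" "x k = max_nbr_queue x j"
      using max_nbr_queue_attained[of x j] by blast
    let ?S = "nbrs G {j} \<inter> supp G x" and ?m = "real (max_nbr_queue x j)"
    have kS: "k \<in> ?S" using k False by (auto simp: supp_def nbrs_def)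
    then have ne: "?S \<noteq> {}" by blast
    \<comment> \<open>For a maximiser \<open>i\<close>, \<open>x k - B \<le> score x j \<omega> k
      \<le> score x j \<omega> i \<le> x i + B + W\<close>. The truncation at 0 is harmless since
      \<open>x i + B\<close> is nonnegative.\<close>
    have good: "?m - C \<le> real (x i)"
      if \<omega>: "\<omega> \<in> A" and i: "i \<in> mw_argmax G w U x j \<omega>" for i \<omega>
    proof -
      have le: "score x j \<omega> k \<le> score x j \<omega> i" and iS: "i \<in> ?S"
        using i kS unfolding mem_mw_argmax_iff by auto
      have arcs: "(j, i) \<in> parcs G" "(j, k) \<in> parcs G"
        using iS kS by (auto simp: mem_nbrs_single)
      then have "\<bar>U (j, i) \<omega>\<bar> \<le> B" "\<bar>U (j, k) \<omega>\<bar> \<le> B"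
        using \<omega> by (auto simp: A_def)
      moreover have "w (j, i) \<le> W" "0 \<le> w (j, k)"
        using arcs wW reward_nonneg by auto
      ultimately show ?thesis
        using le k(2) unfolding score_def C_def by linarith
    qed
    \<comment> \<open>Off \<open>A\<close> the left side vanishes and the matched queue is merely
      nonnegative, so large errors need no estimate.\<close>
    have pt: "indicator A \<omega> * (?m - C) \<le> (\<Sum>i\<in>?S. choice_weight x j i \<omega> * real (x i))" for \<omega>
    proof (cases "\<omega> \<in> A")
      case True
      have "?m - C = (\<Sum>i\<in>?S. choice_weight x j i \<omega> * (?m - C))"
        unfolding sum_distrib_right[symmetric] sum_choice_weight[OF ne] by simp
      also have "\<dots> \<le> (\<Sum>i\<in>?S. choice_weight x j i \<omega> * real (x i))"
      proof (rule sum_mono)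
        fix i
        show "choice_weight x j i \<omega> * (?m - C) \<le> choice_weight x j i \<omega> * real (x i)"
        proof (cases "i \<in> mw_argmax G w U x j \<omega>")
          case i: True
          show ?thesis
            using good[OF True i] by (intro mult_left_mono) (auto simp: choice_weight_def)
        qed (simp add: choice_weight_eq[OF ne])
      qed
      finally show ?thesis using True by simp
    qed (simp add: sum_nonneg choice_weight_def)
    have "prob A * (?m - C) = expectation (\<lambda>\<omega>. indicator A \<omega> * (?m - C))"
      using B(2) by (simp add: A_def)
    also have "\<dots> \<le> expectation (\<lambda>\<omega>. \<Sum>i\<in>?S. choice_weight x j i \<omega> * real (x i))"
      using B(2) choice_weight_integrable[OF ne] pt
      by (intro integral_mono) (auto simp: A_def[symmetric] emeasure_eq_measure)
    also have "\<dots> = (\<Sum>i\<in>?S. match_prob G w M U x j i * real (x i))"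
      using choice_weight_integrable[OF ne]
      by (simp add: match_prob_eq Bochner_Integration.integral_sum del: Int_iff)
    finally have "prob A * (?m - C) \<le> (\<Sum>i\<in>?S. match_prob G w M U x j i * real (x i))" .
    \<comment> \<open>The difference \<open>?m - C\<close> may be negative, so \<open>prob A\<close>
      is bounded below in front of \<open>?m\<close> and above in front of \<open>C\<close>.\<close>
    moreover have "(1 - \<epsilon>) * ?m \<le> prob A * ?m"
      using B(3) by (intro mult_right_mono) (auto simp: A_def)
    moreover have "prob A * C \<le> 1 * C"
      using C by (intro mult_right_mono) auto
    ultimately show ?thesis by (simp add: algebra_simps)
  qed
  then show thesis using that C by blast
qed

section \<open>Generator bound for the exponential of the norm\<close>

text \<open>Counts the arcs between arriving and stored classes in two ways: the generator groups
  matches by the departing class, the matching estimates by the arriving one.\<close>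

lemma sum_nbrs_swap:
  "(\<Sum>i\<in>supp G x. \<Sum>j\<in>nbrs G {i}. h i j) = (\<Sum>j\<in>pverts G. \<Sum>i\<in>nbrs G {j} \<inter> supp G x. h i j)"
proof -
  have "(\<Sum>i\<in>supp G x. \<Sum>j\<in>{j \<in> pverts G. (j, i) \<in> parcs G}. h i j) =
      (\<Sum>j\<in>pverts G. \<Sum>i\<in>{i \<in> supp G x. (j, i) \<in> parcs G}. h i j)"
    by (rule sum.swap_restrict) (auto simp: supp_def)
  moreover have "{j \<in> pverts G. (j, i) \<in> parcs G} = nbrs G {i}" for i
    by (auto simp: nbrs_def)
  moreover have "{i \<in> supp G x. (j, i) \<in> parcs G} = nbrs G {j} \<inter> supp G x" for j
    by (auto simp: mem_nbrs_single)
  ultimately show ?thesis by simp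
qed

text \<open>The exponent changes by \<open>\<alpha> * d\<close> with
  \<open>0 \<le> d \<le> 1\<close>. Its square is at most \<open>\<alpha>\<^sup>2\<close>, which
  becomes the summand \<open>\<alpha> * N\<close> once \<open>\<alpha> / N\<close> is factored
  out.\<close>

lemma exp_norm_incr_le:
  assumes "0 < \<alpha>" "\<alpha> \<le> 1" and i: "i \<in> pverts G" and N: "1 \<le> state_norm G x"
  shows "exp (\<alpha> * state_norm G (x(i := x i + 1))) - exp (\<alpha> * state_norm G x) \<le>
    exp (\<alpha> * state_norm G x) * (\<alpha> / state_norm G x) *
      (real (x i) + (1 / 2 + \<alpha> * state_norm G x))"
proof -
  define N d where "N = state_norm G x" and "d = state_norm G (x(i := x i + 1)) - N"
  have d: "0 \<le> d" "d \<le> 1" "d \<le> (2 * real (x i) + 1) / (2 * N)"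
    using state_norm_incr[OF i N] by (auto simp: d_def N_def)
  have "\<bar>\<alpha> * d\<bar> \<le> 1"
    using assms(1,2) d by (simp add: abs_mult mult_le_one)
  then have "exp (\<alpha> * d) - 1 \<le> \<alpha> * d + (\<alpha> * d)\<^sup>2"
    using exp_le_one_plus_quadratic[of "\<alpha> * d"] by simp
  also have "(\<alpha> * d)\<^sup>2 \<le> \<alpha>\<^sup>2"
    using assms(1) d by (intro power_mono) (auto simp: mult_left_le)
  also have "\<alpha> * d \<le> \<alpha> * ((2 * real (x i) + 1) / (2 * N))"
    using assms(1) d by (intro mult_left_mono) auto
  finally have "exp (\<alpha> * d) - 1 \<le> (\<alpha> / N) * (real (x i) + (1 / 2 + \<alpha> * N))"
    using N by (simp add: N_def[symmetric] field_simps power2_eq_square)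
  then have "exp (\<alpha> * N) * (exp (\<alpha> * d) - 1) \<le> exp (\<alpha> * N) * ((\<alpha> / N) * (real (x i) + (1 / 2 + \<alpha> * N)))"
    by (intro mult_left_mono) auto
  moreover have "exp (\<alpha> * state_norm G (x(i := x i + 1))) = exp (\<alpha> * N) * exp (\<alpha> * d)"
    by (simp add: d_def exp_add[symmetric] algebra_simps)
  ultimately show ?thesis
    unfolding N_def[symmetric] by (simp only: right_diff_distrib mult_1_right mult.assoc)
qed

text \<open>The first bound has the sharp coefficient of \<open>x i\<close> and serves for matches,
  whose total rate is bounded. Reneging rates grow with the queue and would amplify its additive
  error; the second bound gives up a factor 4 to have none.\<close>

lemma exp_norm_decr_le:
  assumes "0 < \<alpha>" "\<alpha> \<le> 1 / 2" and i: "i \<in> pverts G" "0 < x i" and N: "1 \<le> state_norm G x"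
  defines "D \<equiv> exp (\<alpha> * state_norm G (x(i := x i - 1))) - exp (\<alpha> * state_norm G x)"
    and "c \<equiv> exp (\<alpha> * state_norm G x) * (\<alpha> / state_norm G x)"
  shows "D \<le> c * ((1 / 2 + \<alpha> * state_norm G x) - real (x i))" and "D \<le> c * (- real (x i) / 4)"
proof -
  define N d where "N = state_norm G x" and "d = state_norm G (x(i := x i - 1)) - N"
  have d: "d \<le> 0" "-1 \<le> d" "d \<le> (1 - 2 * real (x i)) / (2 * N)"
    using state_norm_decr[OF i N] by (auto simp: d_def N_def)
  have x: "1 \<le> real (x i)" using i by simp
  have N: "1 \<le> N" using N by (simp add: N_def)
  have "\<bar>d\<bar> \<le> 1" using d by simp
  then have "\<bar>\<alpha> * d\<bar> \<le> 1"
    using assms(1,2) unfolding abs_mult by (intro mult_le_one) auto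
  then have ex: "exp (\<alpha> * d) - 1 \<le> \<alpha> * d + (\<alpha> * d)\<^sup>2"
    using exp_le_one_plus_quadratic[of "\<alpha> * d"] by simp
  have "d\<^sup>2 \<le> 1"
    using \<open>\<bar>d\<bar> \<le> 1\<close> by (simp add: abs_square_le_1)
  then have "\<alpha> * d + (\<alpha> * d)\<^sup>2 \<le> \<alpha> * ((1 - 2 * real (x i)) / (2 * N)) + \<alpha>\<^sup>2"
    using assms(1) d
    by (intro add_mono mult_left_mono) (auto simp: power_mult_distrib mult_left_le)
  also have "\<dots> = (\<alpha> / N) * ((1 / 2 + \<alpha> * N) - real (x i))"
    using N by (simp add: field_simps power2_eq_square)
  finally have 1: "exp (\<alpha> * d) - 1 \<le> (\<alpha> / N) * ((1 / 2 + \<alpha> * N) - real (x i))"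
    using ex by simp
  \<comment> \<open>For \<open>u\<close> between \<open>-1/2\<close> and 0,
    \<open>u + u\<^sup>2 \<le> u / 2\<close>; this is where \<open>\<alpha> \<le> 1 / 2\<close>
    enters.\<close>
  have "(1 + \<alpha> * d) * (\<alpha> * d) \<le> 1 / 2 * (\<alpha> * d)"
  proof (rule mult_right_mono_neg)
    have "\<alpha> * (- d) \<le> \<alpha> * 1"
      using assms(1) d by (intro mult_left_mono) auto
    then show "1 / 2 \<le> 1 + \<alpha> * d" using assms(2) by simp
    show "\<alpha> * d \<le> 0" using assms(1) d by (simp add: mult_nonneg_nonpos)
  qed
  then have "\<alpha> * d + (\<alpha> * d)\<^sup>2 \<le> \<alpha> / 2 * d"
    by (simp add: algebra_simps power2_eq_square)
  \<comment> \<open>From \<open>x i \<ge> 1\<close>, \<open>1 - 2 * x i \<le> - x i\<close>: the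
    second factor 1/2 of the final 1/4.\<close>
  also have "d \<le> - real (x i) / (2 * N)"
    using d(3) x N by (simp add: field_simps)
  then have "\<alpha> / 2 * d \<le> \<alpha> / 2 * (- real (x i) / (2 * N))"
    using assms(1) by (intro mult_left_mono) auto
  finally have 2: "exp (\<alpha> * d) - 1 \<le> (\<alpha> / N) * (- real (x i) / 4)"
    using ex by (simp add: field_simps)
  have D: "D = exp (\<alpha> * N) * (exp (\<alpha> * d) - 1)"
    by (simp add: D_def N_def d_def exp_add[symmetric] algebra_simps)
  show "D \<le> c * ((1 / 2 + \<alpha> * state_norm G x) - real (x i))"
    using mult_left_mono[OF 1, of "exp (\<alpha> * N)"] unfolding D c_def N_def[symmetric]
    by (simp only: mult.assoc exp_ge_zero)
  show "D \<le> c * (- real (x i) / 4)"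
    using mult_left_mono[OF 2, of "exp (\<alpha> * N)"] unfolding D c_def N_def[symmetric]
    by (simp only: mult.assoc exp_ge_zero)
qed

text \<open>Arrivals and matches each have total rate at most \<open>sum lam (pverts G)\<close> and
  an error \<open>\<kappa> = 1 / 2 + \<alpha> * N\<close> per event; together they give the last
  summand. Reneging contributes only the quadratic term.\<close>

lemma generator_exp_norm_le:
  assumes \<alpha>: "0 < \<alpha>" "\<alpha> \<le> 1 / 2" and N: "1 \<le> state_norm G x"
  shows "generator G w lam \<gamma> M U (\<lambda>y. exp (\<alpha> * state_norm G y)) x \<le>
    exp (\<alpha> * state_norm G x) * (\<alpha> / state_norm G x) *
     ((\<Sum>i\<in>pverts G. lam i * real (x i)) -
      (\<Sum>j\<in>pverts G. lam j * (\<Sum>i\<in>nbrs G {j} \<inter> supp G x. match_prob G w M U x j i * real (x i))) -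
      (\<Sum>i\<in>pverts G. \<gamma> i * (real (x i))\<^sup>2 / 4) +
      sum lam (pverts G) * (1 + 2 * \<alpha> * state_norm G x))"
proof -
  define c where "c = exp (\<alpha> * state_norm G x) * (\<alpha> / state_norm G x)"
  define \<kappa> where "\<kappa> = 1 / 2 + \<alpha> * state_norm G x"
  define s where "s i = (\<Sum>j\<in>nbrs G {i}. lam j * match_prob G w M U x j i)" for i
  define f where "f = (\<lambda>y. exp (\<alpha> * state_norm G y))"
  define q where "q j = (\<Sum>i\<in>nbrs G {j} \<inter> supp G x. match_prob G w M U x j i * real (x i))" for j
  have c: "0 \<le> c" using \<alpha> N by (simp add: c_def)
  have \<kappa>: "0 \<le> \<kappa>" using \<alpha> N by (simp add: \<kappa>_def)
  have s: "0 \<le> s i" for i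
    unfolding s_def using lam_nonneg match_prob_nonneg
    by (intro sum_nonneg mult_nonneg_nonneg) (auto simp: nbrs_def)
  have "(\<Sum>i\<in>pverts G - nbrs G (supp G x). lam i * (f (x(i := x i + 1)) - f x))
      \<le> (\<Sum>i\<in>pverts G - nbrs G (supp G x). lam i * (c * (real (x i) + \<kappa>)))"
    using exp_norm_incr_le[OF \<alpha>(1) _ _ N] \<alpha>(2) lam_nonneg
    unfolding f_def c_def \<kappa>_def by (intro sum_mono mult_left_mono) auto
  \<comment> \<open>The added terms are nonnegative. In a state, a class adjacent to a stored one
    has an empty queue, so only its \<open>\<kappa>\<close> term is lost.\<close>
  also have "\<dots> \<le> (\<Sum>i\<in>pverts G. lam i * (c * (real (x i) + \<kappa>)))"
    using c \<kappa> lam_nonneg by (intro sum_mono2) auto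
  also have "\<dots> = c * ((\<Sum>i\<in>pverts G. lam i * real (x i)) + sum lam (pverts G) * \<kappa>)"
    by (simp add: sum_distrib_left sum_distrib_right sum.distrib[symmetric] algebra_simps)
  finally have up: "(\<Sum>i\<in>pverts G - nbrs G (supp G x). lam i * (f (x(i := x i + 1)) - f x))
      \<le> c * ((\<Sum>i\<in>pverts G. lam i * real (x i)) + sum lam (pverts G) * \<kappa>)" .

  have "(\<Sum>i\<in>supp G x. (\<gamma> i * real (x i) + s i) * (f (x(i := x i - 1)) - f x))
      \<le> (\<Sum>i\<in>supp G x. \<gamma> i * real (x i) * (c * (- real (x i) / 4)) + s i * (c * (\<kappa> - real (x i))))"
  proof (rule sum_mono)
    fix i assume "i \<in> supp G x"
    then have i: "i \<in> pverts G" "0 < x i" by (auto simp: supp_def)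
    note D = exp_norm_decr_le[OF \<alpha> i N, folded c_def \<kappa>_def]
    show "(\<gamma> i * real (x i) + s i) * (f (x(i := x i - 1)) - f x) \<le>
        \<gamma> i * real (x i) * (c * (- real (x i) / 4)) + s i * (c * (\<kappa> - real (x i)))"
      unfolding distrib_right f_def
      using D s reneging_nonneg[OF i(1)] by (intro add_mono mult_left_mono) auto
  qed
  also have "\<dots> = c * (\<kappa> * (\<Sum>i\<in>supp G x. s i) - (\<Sum>i\<in>supp G x. s i * real (x i))
      - (\<Sum>i\<in>supp G x. \<gamma> i * (real (x i))\<^sup>2 / 4))"
    by (simp add: sum_distrib_left sum.distrib[symmetric] sum_subtractf[symmetric]
        algebra_simps power2_eq_square)
  also have "(\<Sum>i\<in>supp G x. \<gamma> i * (real (x i))\<^sup>2 / 4) = (\<Sum>i\<in>pverts G. \<gamma> i * (real (x i))\<^sup>2 / 4)"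
    by (rule sum.mono_neutral_left) (auto simp: supp_def)
  also have "(\<Sum>i\<in>supp G x. s i * real (x i)) = (\<Sum>j\<in>pverts G. lam j * q j)"
    unfolding s_def q_def sum_distrib_left sum_distrib_right sum_nbrs_swap by (simp add: mult.assoc)
  also have "(\<Sum>i\<in>supp G x. s i) =
      (\<Sum>j\<in>pverts G. lam j * (\<Sum>i\<in>nbrs G {j} \<inter> supp G x. match_prob G w M U x j i))"
    unfolding s_def sum_distrib_left sum_nbrs_swap ..
  finally have down: "(\<Sum>i\<in>supp G x. (\<gamma> i * real (x i) + s i) * (f (x(i := x i - 1)) - f x))
      \<le> c * (\<kappa> * (\<Sum>j\<in>pverts G. lam j * (\<Sum>i\<in>nbrs G {j} \<inter> supp G x. match_prob G w M U x j i))
        - (\<Sum>j\<in>pverts G. lam j * q j) - (\<Sum>i\<in>pverts G. \<gamma> i * (real (x i))\<^sup>2 / 4))" .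
  have "(\<Sum>j\<in>pverts G. lam j * (\<Sum>i\<in>nbrs G {j} \<inter> supp G x. match_prob G w M U x j i))
      \<le> (\<Sum>j\<in>pverts G. lam j * 1)"
    using sum_match_prob_le_1 lam_nonneg by (intro sum_mono mult_left_mono) auto
  then have "\<kappa> * (\<Sum>j\<in>pverts G. lam j * (\<Sum>i\<in>nbrs G {j} \<inter> supp G x. match_prob G w M U x j i))
      \<le> \<kappa> * sum lam (pverts G)"
    using \<kappa> by (intro mult_left_mono) auto
  then have "c * (\<kappa> * (\<Sum>j\<in>pverts G. lam j * (\<Sum>i\<in>nbrs G {j} \<inter> supp G x. match_prob G w M U x j i))
        - (\<Sum>j\<in>pverts G. lam j * q j) - (\<Sum>i\<in>pverts G. \<gamma> i * (real (x i))\<^sup>2 / 4))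
      \<le> c * (\<kappa> * sum lam (pverts G)
        - (\<Sum>j\<in>pverts G. lam j * q j) - (\<Sum>i\<in>pverts G. \<gamma> i * (real (x i))\<^sup>2 / 4))"
    using c by (intro mult_left_mono) auto
  with up down have "generator G w lam \<gamma> M U f x \<le>
      c * ((\<Sum>i\<in>pverts G. lam i * real (x i)) + sum lam (pverts G) * \<kappa>) +
      c * (\<kappa> * sum lam (pverts G)
        - (\<Sum>j\<in>pverts G. lam j * q j) - (\<Sum>i\<in>pverts G. \<gamma> i * (real (x i))\<^sup>2 / 4))"
    unfolding generator_def s_def by linarith
  also have "\<dots> = c * ((\<Sum>i\<in>pverts G. lam i * real (x i)) - (\<Sum>j\<in>pverts G. lam j * q j)
      - (\<Sum>i\<in>pverts G. \<gamma> i * (real (x i))\<^sup>2 / 4) + sum lam (pverts G) * (2 * \<kappa>))"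
    by (simp add: algebra_simps)
  also have "2 * \<kappa> = 1 + 2 * \<alpha> * state_norm G x"
    by (simp add: \<kappa>_def)
  finally show ?thesis unfolding f_def c_def q_def .
qed

section \<open>Negative drift for long queues\<close>

text \<open>Raise every rate by \<open>\<delta>\<close>. The slack absorbs this on classes with
  \<open>\<gamma> i = 0\<close>, the quadratic term on the others up to a constant. The surplus is
  \<open>\<delta>\<close> times the sum of the queues, which dominates the Euclidean norm.\<close>

lemma queue_drift_le:
  assumes gap: "\<And>I. I \<in> indep_sets_in G {i \<in> pverts G. \<gamma> i = 0} \<Longrightarrow>
      (\<Sum>i\<in>I. lam i + \<delta>) \<le> sum lam (nbrs G I)"
    and x: "x \<in> state_space G" and \<delta>: "0 < \<delta>"
  shows "(\<Sum>i\<in>pverts G. lam i * real (x i)) - (\<Sum>j\<in>pverts G. lam j * real (max_nbr_queue x j)) -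
      (\<Sum>i\<in>pverts G. \<gamma> i * (real (x i))\<^sup>2 / 4) \<le>
    (\<Sum>i\<in>{i \<in> pverts G. 0 < \<gamma> i}. (lam i + \<delta>)\<^sup>2 / \<gamma> i) - \<delta> * state_norm G x"
proof -
  let ?S = "{i \<in> pverts G. \<gamma> i = 0}" and ?R = "{i \<in> pverts G. 0 < \<gamma> i}"
  have split: "sum h (pverts G) = sum h ?S + sum h ?R" for h :: "'v \<Rightarrow> real"
  proof -
    have "pverts G = ?S \<union> ?R" using reneging_nonneg by force
    then have "sum h (pverts G) = sum h (?S \<union> ?R)" by (rule arg_cong)
    also have "\<dots> = sum h ?S + sum h ?R" by (rule sum.union_disjoint) auto
    finally show ?thesis .
  qed
  have "(\<Sum>i\<in>?S. (lam i + \<delta>) * real (x i)) \<le> (\<Sum>j\<in>pverts G. lam j * real (max_nbr_queue x j))"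
    by (rule sum_queue_le_sum_max_nbr_queue[OF lam_nonneg gap _ x]) auto
  moreover have "(\<Sum>i\<in>?R. (lam i + \<delta>) * real (x i)) - (\<Sum>i\<in>?R. \<gamma> i * (real (x i))\<^sup>2 / 4) \<le>
      (\<Sum>i\<in>?R. (lam i + \<delta>)\<^sup>2 / \<gamma> i)"
    unfolding sum_subtractf[symmetric] using linear_minus_quadratic_le by (intro sum_mono) auto
  moreover have "(\<Sum>i\<in>pverts G. \<gamma> i * (real (x i))\<^sup>2 / 4) = (\<Sum>i\<in>?R. \<gamma> i * (real (x i))\<^sup>2 / 4)"
    unfolding split[of "\<lambda>i. \<gamma> i * (real (x i))\<^sup>2 / 4"] by simp
  moreover have "(\<Sum>i\<in>pverts G. (lam i + \<delta>) * real (x i)) =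
      (\<Sum>i\<in>pverts G. lam i * real (x i)) + \<delta> * (\<Sum>i\<in>pverts G. real (x i))"
    by (simp add: sum.distrib distrib_right sum_distrib_left)
  moreover have "\<delta> * state_norm G x \<le> \<delta> * (\<Sum>i\<in>pverts G. real (x i))"
    using state_norm_le_sum[of x] \<delta> by simp
  ultimately show ?thesis
    using split[of "\<lambda>i. (lam i + \<delta>) * real (x i)"] by linarith
qed

lemma generator_exp_norm_drift:
  assumes "lam \<in> Ncond G \<gamma>"
  shows "\<exists>\<alpha>\<^sub>0>0. \<forall>\<alpha>. 0 < \<alpha> \<and> \<alpha> < \<alpha>\<^sub>0 \<longrightarrow>
    (\<exists>C>0. \<exists>K>0. \<forall>x\<in>state_space G. K \<le> state_norm G x \<longrightarrow>
       generator G w lam \<gamma> M U (\<lambda>y. exp (\<alpha> * state_norm G y)) x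
         \<le> - C * exp (\<alpha> * state_norm G x))"
proof -
  obtain \<delta> where \<delta>: "0 < \<delta>" and
    gap: "\<And>I. I \<in> indep_sets_in G {i \<in> pverts G. \<gamma> i = 0} \<Longrightarrow>
       (\<Sum>i\<in>I. lam i + \<delta>) \<le> sum lam (nbrs G I)"
    using Ncond_uniform_gap[OF assms] by blast
  define \<Lambda> where "\<Lambda> = sum lam (pverts G)"
  have \<Lambda>: "0 \<le> \<Lambda>" unfolding \<Lambda>_def by (intro sum_nonneg lam_nonneg)
  \<comment> \<open>Chosen so that the matching loss \<open>\<Lambda> * \<epsilon> * N\<close> uses
    at most a quarter of \<open>\<delta> * N\<close>; the \<open>+ 1\<close> makes the denominator
    positive from \<open>0 \<le> \<Lambda>\<close> alone.\<close>
  define \<epsilon> where "\<epsilon> = \<delta> / (4 * (\<Lambda> + 1))"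
  have \<epsilon>: "0 < \<epsilon>" using \<delta> \<Lambda> by (simp add: \<epsilon>_def)
  have \<Lambda>\<epsilon>: "\<Lambda> * \<epsilon> \<le> \<delta> / 4" using \<delta> \<Lambda> by (simp add: \<epsilon>_def field_simps)
  obtain C where C: "0 \<le> C" and
    q: "\<And>x j. (1 - \<epsilon>) * real (max_nbr_queue x j) - C \<le>
       (\<Sum>i\<in>nbrs G {j} \<inter> supp G x. match_prob G w M U x j i * real (x i))"
    using expected_matched_queue_ge[OF \<epsilon>] by blast
  \<comment> \<open>All constant terms: the cost of the reneging classes, the matching constant
    weighted by the rates, and the constant part of the second-order error.\<close>
  define B where "B = (\<Sum>i\<in>{i \<in> pverts G. 0 < \<gamma> i}. (lam i + \<delta>)\<^sup>2 / \<gamma> i) + \<Lambda> * C + \<Lambda>"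
  \<comment> \<open>The \<open>1\<close> is for the norm estimates; the other entry makes
    \<open>B\<close> at most a quarter of \<open>\<delta> * N\<close>.\<close>
  define K where "K = max 1 (4 * B / \<delta>)"
  \<comment> \<open>The bound \<open>1 / 2\<close> is for the decrease estimate;
    \<open>\<epsilon> / 2\<close> makes \<open>2 * \<Lambda> * \<alpha> * N\<close> at most a
    quarter of \<open>\<delta> * N\<close>.\<close>
  define \<alpha>\<^sub>0 where "\<alpha>\<^sub>0 = min (1 / 2) (\<epsilon> / 2)"
  \<comment> \<open>The decay constant to be exhibited is \<open>\<alpha> * \<delta> / 4\<close>,
    not the matching constant \<open>C\<close> above; \<open>K\<close> serves for every
    \<open>\<alpha>\<close>.\<close>
  have drift: "generator G w lam \<gamma> M U (\<lambda>y. exp (\<alpha> * state_norm G y)) x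
      \<le> - (\<alpha> * \<delta> / 4) * exp (\<alpha> * state_norm G x)"
    if \<alpha>: "0 < \<alpha>" "\<alpha> < \<alpha>\<^sub>0" and x: "x \<in> state_space G" and K: "K \<le> state_norm G x" for \<alpha> x
  proof -
    define N where "N = state_norm G x"
    define q' where "q' j = (\<Sum>i\<in>nbrs G {j} \<inter> supp G x. match_prob G w M U x j i * real (x i))" for j
    have N: "1 \<le> N" "4 * B \<le> \<delta> * N"
      using K \<delta> by (auto simp: K_def N_def field_simps)
    have "real (max_nbr_queue x j) - (\<epsilon> * N + C) \<le> q' j" for j
    proof -
      have "\<epsilon> * real (max_nbr_queue x j) \<le> \<epsilon> * N"
        using max_nbr_queue_le_norm \<epsilon> by (simp add: N_def)
      then show ?thesis using q[of x j] by (simp add: q'_def algebra_simps)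
    qed
    then have "(\<Sum>j\<in>pverts G. lam j * (real (max_nbr_queue x j) - (\<epsilon> * N + C))) \<le>
        (\<Sum>j\<in>pverts G. lam j * q' j)"
      using lam_nonneg by (intro sum_mono mult_left_mono) auto
    then have q'': "(\<Sum>j\<in>pverts G. lam j * real (max_nbr_queue x j)) - \<Lambda> * \<epsilon> * N - \<Lambda> * C \<le>
        (\<Sum>j\<in>pverts G. lam j * q' j)"
      unfolding right_diff_distrib sum_subtractf sum_distrib_right[symmetric] \<Lambda>_def[symmetric]
      by (simp add: algebra_simps)
    have "\<Lambda> * \<alpha> \<le> \<Lambda> * (\<epsilon> / 2)"
      using \<alpha> \<Lambda> by (intro mult_left_mono) (auto simp: \<alpha>\<^sub>0_def)
    then have "\<Lambda> * \<epsilon> * N \<le> \<delta> / 4 * N" "2 * (\<Lambda> * \<alpha>) * N \<le> \<delta> / 4 * N"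
      using \<Lambda>\<epsilon> N by (auto intro!: mult_right_mono)
    \<comment> \<open>Of the drift \<open>- \<delta> * N\<close>, one quarter each pays for
      \<open>B\<close>, for the matching loss and for the second-order error; one quarter remains,
      and its \<open>N\<close> cancels the \<open>1 / N\<close> in front.\<close>
    then have br: "(\<Sum>i\<in>pverts G. lam i * real (x i)) - (\<Sum>j\<in>pverts G. lam j * q' j) -
        (\<Sum>i\<in>pverts G. \<gamma> i * (real (x i))\<^sup>2 / 4) + \<Lambda> * (1 + 2 * \<alpha> * N) \<le> - (\<delta> / 4) * N"
      using queue_drift_le[OF gap x \<delta>] q'' N(2)
      unfolding B_def N_def[symmetric] by (simp add: algebra_simps)
    have "generator G w lam \<gamma> M U (\<lambda>y. exp (\<alpha> * state_norm G y)) x \<le>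
        exp (\<alpha> * N) * (\<alpha> / N) * ((\<Sum>i\<in>pverts G. lam i * real (x i)) - (\<Sum>j\<in>pverts G. lam j * q' j) -
        (\<Sum>i\<in>pverts G. \<gamma> i * (real (x i))\<^sup>2 / 4) + \<Lambda> * (1 + 2 * \<alpha> * N))"
      using generator_exp_norm_le[of \<alpha> x] \<alpha> N
      by (simp add: N_def \<Lambda>_def q'_def \<alpha>\<^sub>0_def)
    also have "\<dots> \<le> exp (\<alpha> * N) * (\<alpha> / N) * (- (\<delta> / 4) * N)"
      using br \<alpha> N by (intro mult_left_mono) auto
    also have "\<dots> = - (\<alpha> * \<delta> / 4) * exp (\<alpha> * N)"
      using N by simp
    finally show ?thesis unfolding N_def .
  qed
  have "0 < \<alpha>\<^sub>0" "0 < K" using \<epsilon> by (auto simp: \<alpha>\<^sub>0_def K_def)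
  moreover have "0 < \<alpha> * \<delta> / 4" if "0 < \<alpha>" for \<alpha> using that \<delta> by simp
  ultimately show ?thesis using drift by metis
qed

end

theorem proposition3p6:
  fixes G :: "'v pair_pre_digraph"
    and w :: "'v \<times> 'v \<Rightarrow> real"
    and F :: "'v \<times> 'v \<Rightarrow> real \<Rightarrow> real"
    and lam \<gamma> :: "'v \<Rightarrow> real"
    and M :: "'m measure"
    and U :: "'v \<times> 'v \<Rightarrow> 'm \<Rightarrow> real"
  assumes "stochastic_matching_model G w F lam \<gamma> M U"
    and "lam \<in> Ncond G \<gamma>"
  shows "\<exists>\<alpha>\<^sub>0>0. \<forall>\<alpha>. 0 < \<alpha> \<and> \<alpha> < \<alpha>\<^sub>0 \<longrightarrow>
    (\<exists>C>0. \<exists>K>0. \<forall>x\<in>state_space G. K \<le> state_norm G x \<longrightarrow>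
       generator G w lam \<gamma> M U (\<lambda>y. exp (\<alpha> * state_norm G y)) x
         \<le> - C * exp (\<alpha> * state_norm G x))"
  using stochastic_matching_model.generator_exp_norm_drift[OF assms] .

end
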